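(* Let $H_1$ be an $r_1$-regular graph with $n_1$ vertices and let $H_2$ be an $r_2$-regular graph with $n_2$ vertices. If $n_1-r_2=n_2-r_1>\max\{r_1,r_2\}$, then $G=H_1\bigtriangledown H_2$ is an $A$-exact graph.
   Context: All graphs are finite, simple and unweighted. The join $H_1\bigtriangledown H_2$ of two graphs on disjoint vertex sets is obtained from their disjoint union by adding all edges $uv$ with $u\in V(H_1)$, $v\in V(H_2)$. For a graph $G=(V,E)$ on $n$ vertices, $\lambda_n(G)$ is the smallest eigenvalue of the adjacency matrix $A(G)$; $W=|E|$; $mcut(G)$ is the maximum over $X\subseteq V$ of the number of edges with exactly one endpoint in $X$. $G$ is $A$-exact if $\lambda_n(G)=\frac{2}{n}(W-2\,mcut(G))$. *)

theory Defs
  imports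
    "Graph_Theory.Pair_Digraph"
    "Jordan_Normal_Form.Spectral_Radius"
    "HOL-Library.Countable_Set"
begin

text \<open>
  A finite simple graph is a \<^locale>\<open>pair_graph\<close>: a finite vertex set together with a symmetric,
  irreflexive set of arcs, so that an undirected edge between \<open>u\<close> and \<open>v\<close> is present as the two
  arcs \<open>(u, v)\<close> and \<open>(v, u)\<close>.
\<close>

text \<open>Each edge is counted once, as the unordered pair of its endpoints.\<close>

definition edges :: "'a pair_pre_digraph \<Rightarrow> 'a set set" where
  "edges G = {{u, v} | u v. (u, v) \<in> parcs G}"

definition regular_graph :: "nat \<Rightarrow> 'a pair_pre_digraph \<Rightarrow> bool" where
  "regular_graph r G \<longleftrightarrow> pair_graph G \<and> (\<forall>v \<in> pverts G. out_degree (with_proj G) v = r)"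

text \<open>Only meant for graphs with disjoint vertex sets.\<close>

definition graph_join :: "'a pair_pre_digraph \<Rightarrow> 'a pair_pre_digraph \<Rightarrow> 'a pair_pre_digraph" where
  "graph_join H1 H2 =
     \<lparr> pverts = pverts H1 \<union> pverts H2,
       parcs = parcs H1 \<union> parcs H2
         \<union> pverts H1 \<times> pverts H2 \<union> pverts H2 \<times> pverts H1 \<rparr>"

lemma pair_graph_graph_join:
  assumes "pair_graph H1" "pair_graph H2" "pverts H1 \<inter> pverts H2 = {}"
  shows "pair_graph (graph_join H1 H2)"
proof -
  interpret A: pair_graph H1 by fact
  interpret B: pair_graph H2 by fact
  have "sym (parcs H1)" "sym (parcs H2)"
    using A.pair_sym_arcs B.pair_sym_arcs by (simp_all add: symmetric_def)
  then have "sym (parcs (graph_join H1 H2))"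
    by (auto simp: graph_join_def sym_def)
  then show ?thesis
    using assms(3) A.pair_finite_verts B.pair_finite_verts A.pair_finite_arcs B.pair_finite_arcs
    by unfold_locales
      (auto simp: graph_join_def symmetric_def dest: A.in_arcsD1 A.in_arcsD2 B.in_arcsD1 B.in_arcsD2
        A.pair_no_loops B.pair_no_loops)
qed

definition cut_edges :: "'a pair_pre_digraph \<Rightarrow> 'a set \<Rightarrow> 'a set set" where
  "cut_edges G X = {e \<in> edges G. card (e \<inter> X) = 1}"

definition mcut :: "'a pair_pre_digraph \<Rightarrow> nat" where
  "mcut G = Max ((\<lambda>X. card (cut_edges G X)) ` Pow (pverts G))"

text \<open>
  The rows and columns are labelled by the vertices through \<^const>\<open>from_nat_into\<close>, which for a
  finite set \<open>V\<close> is a bijection from \<open>{..<card V}\<close> onto \<open>V\<close>. Another labelling yields a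
  permutation-similar matrix, hence the same eigenvalues.
\<close>

definition adjacency_matrix :: "'a pair_pre_digraph \<Rightarrow> real mat" where
  "adjacency_matrix G = mat (card (pverts G)) (card (pverts G))
     (\<lambda>(i, j). if (from_nat_into (pverts G) i, from_nat_into (pverts G) j) \<in> parcs G
               then 1 else 0)"

text \<open>
  The adjacency matrix is real symmetric, so all its eigenvalues are real and the smallest one is
  the minimum of its real spectrum (nonempty as soon as there is a vertex).
\<close>

definition least_eigenvalue :: "'a pair_pre_digraph \<Rightarrow> real" where
  "least_eigenvalue G = Min (spectrum (adjacency_matrix G))"

definition A_exact :: "'a pair_pre_digraph \<Rightarrow> bool" where
  "A_exact G \<longleftrightarrow> least_eigenvalue G =
     2 / real (card (pverts G)) * (real (card (edges G)) - 2 * real (mcut G))"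

end

theory Submission
  imports Defs "HOL-Analysis.Convex"
begin

text \<open>
  Give every vertex of \<open>H1\<close> the value \<open>1\<close> and every vertex of \<open>H2\<close> the value \<open>-1\<close>, and put
  \<open>d = n2 - r1 = n1 - r2\<close>. A vertex of \<open>H1\<close> sees \<open>r1\<close> ones and \<open>n2\<close> minus ones, a vertex of \<open>H2\<close>
  sees \<open>r2\<close> minus ones and \<open>n1\<close> ones, so this sign vector is an eigenvector of the join for the
  eigenvalue \<open>-d\<close>. Two things remain: \<open>-d\<close> is the least eigenvalue, and no cut is larger than
  the one between \<open>H1\<close> and \<open>H2\<close>.

  Both follow from one inequality for the quadratic form \<open>Q\<close> of the adjacency matrix, namely
  \<open>Q y \<ge> -d \<parallel>y\<parallel>\<^sup>2\<close> for all real \<open>y\<close>. Evaluated at an eigenvector it bounds the eigenvalue from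
  below. Evaluated at the sign vector of a vertex set \<open>X\<close>, where \<open>Q\<close> equals twice the number of
  uncut edges minus twice the number of cut edges, it says \<open>2 (W - 2 cut X) \<ge> -d n\<close>, with equality
  for the sign vector above; this is simultaneously the maximality of that cut and the formula
  demanded by exactness (\<open>A_exactI\<close>). The inequality is proved for \<open>Q\<close> at arbitrary
  vectors because the sign vectors of the competing cuts are in general not eigenvectors.

  The inequality itself (\<open>adjacency_form_join_regular_ge\<close>) comes from splitting \<open>y\<close> on each side
  into its mean and the rest. On the rest, an \<open>r\<close>-regular graph contributes at least \<open>-r\<close> times
  the squared norm (\<open>adjacency_form_regular_ge\<close>), which \<open>d\<close> outweighs, while for vectors constant on
  each side the claim is a perfect square because \<open>d + r1 = n2\<close> and \<open>d + r2 = n1\<close>.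
\<close>

section \<open>The adjacency form and the spectrum\<close>

text \<open>
  The quadratic form of the adjacency matrix. Summing over arcs makes it independent of how
  the vertices are numbered, and counts each edge twice, as the matrix does.
\<close>

definition adjacency_form :: "'a pair_pre_digraph \<Rightarrow> ('a \<Rightarrow> real) \<Rightarrow> real" where
  "adjacency_form G y = (\<Sum>(u, v) \<in> parcs G. y u * y v)"

lemma (in pair_graph) finite_nbrs: "finite {v. (u, v) \<in> parcs G}"
  by (rule finite_subset[OF _ pair_finite_verts]) (auto dest: in_arcsD2)

lemma (in pair_graph) sum_arcs_by_tail:
  fixes f :: "'a \<Rightarrow> 'a \<Rightarrow> real"
  shows "(\<Sum>(u, v) \<in> parcs G. f u v) = (\<Sum>u \<in> pverts G. \<Sum>v | (u, v) \<in> parcs G. f u v)"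
proof -
  have "parcs G = Sigma (pverts G) (\<lambda>u. {v. (u, v) \<in> parcs G})"
    by (auto dest: in_arcsD1)
  moreover have "(\<Sum>u \<in> pverts G. \<Sum>v | (u, v) \<in> parcs G. f u v)
      = (\<Sum>(u, v) \<in> Sigma (pverts G) (\<lambda>u. {v. (u, v) \<in> parcs G}). f u v)"
    by (rule sum.Sigma) (auto simp: finite_nbrs)
  ultimately show ?thesis by simp
qed

lemma (in pair_graph) adjacency_form_eigenvector:
  assumes "\<And>u. u \<in> pverts G \<Longrightarrow> (\<Sum>v | (u, v) \<in> parcs G. y v) = k * y u"
  shows "adjacency_form G y = k * (\<Sum>u \<in> pverts G. (y u)\<^sup>2)"
proof -
  have "adjacency_form G y = (\<Sum>u \<in> pverts G. y u * (\<Sum>v | (u, v) \<in> parcs G. y v))"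
    unfolding adjacency_form_def by (simp add: sum_arcs_by_tail sum_distrib_left)
  also have "\<dots> = (\<Sum>u \<in> pverts G. k * (y u)\<^sup>2)"
    using assms by (intro sum.cong) (auto simp: power2_eq_square)
  finally show ?thesis by (simp add: sum_distrib_left)
qed

lemma (in pair_graph) sum_labels:
  "(\<Sum>i < card (pverts G). f (from_nat_into (pverts G) i)) = (\<Sum>u \<in> pverts G. f u)"
  using sum.reindex_bij_betw[OF bij_betw_from_nat_into_finite[OF pair_finite_verts]] .

lemma (in pair_graph) adjacency_matrix_mult_vec:
  assumes "i < card (pverts G)"
  shows "(adjacency_matrix G *\<^sub>v vec (card (pverts G)) (\<lambda>j. y (from_nat_into (pverts G) j))) $ i
    = (\<Sum>v | (from_nat_into (pverts G) i, v) \<in> parcs G. y v)"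
proof -
  let ?V = "pverts G" and ?l = "from_nat_into (pverts G)"
  have "(adjacency_matrix G *\<^sub>v vec (card ?V) (\<lambda>j. y (?l j))) $ i
      = (\<Sum>j < card ?V. (if (?l i, ?l j) \<in> parcs G then y (?l j) else 0))"
    using assms by (auto simp: adjacency_matrix_def scalar_prod_def lessThan_atLeast0 intro!: sum.cong)
  also have "\<dots> = (\<Sum>v \<in> ?V. (if (?l i, v) \<in> parcs G then y v else 0))"
    by (rule sum_labels)
  also have "\<dots> = (\<Sum>v \<in> {v \<in> ?V. (?l i, v) \<in> parcs G}. y v)"
    by (simp add: sum.inter_filter)
  also have "{v \<in> ?V. (?l i, v) \<in> parcs G} = {v. (?l i, v) \<in> parcs G}"
    by (auto dest: in_arcsD2)
  finally show ?thesis .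
qed

text \<open>
  Through this equivalence the numbering of the vertices disappears: eigenvectors
  become vertex labellings \<open>y\<close> whose sum over the neighbours of \<open>u\<close> is \<open>k * y u\<close>.
\<close>

lemma (in pair_graph) eigenvalue_adjacency_matrix_iff:
  "eigenvalue (adjacency_matrix G) k \<longleftrightarrow>
    (\<exists>y. (\<exists>u \<in> pverts G. y u \<noteq> 0) \<and>
      (\<forall>u \<in> pverts G. (\<Sum>v | (u, v) \<in> parcs G. y v) = k * y u))"
proof -
  let ?V = "pverts G" and ?l = "from_nat_into (pverts G)" and ?n = "card (pverts G)"
  let ?vec = "\<lambda>y. vec ?n (\<lambda>j. y (?l j)) :: real vec"
  have dim: "dim_row (adjacency_matrix G) = ?n" by (simp add: adjacency_matrix_def)
  have bij: "bij_betw ?l {..<?n} ?V"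
    by (rule bij_betw_from_nat_into_finite[OF pair_finite_verts])
  have all: "(\<forall>i < ?n. P (?l i)) \<longleftrightarrow> (\<forall>u \<in> ?V. P u)" for P
    using bij_betw_imp_surj_on[OF bij] by force
  have vecs: "\<exists>y. v = ?vec y" if "v \<in> carrier_vec ?n" for v :: "real vec"
  proof
    show "v = ?vec (\<lambda>u. v $ the_inv_into {..<?n} ?l u)"
      using that bij by (intro eq_vecI) (auto simp: bij_betw_def the_inv_into_f_f)
  qed
  have nz: "?vec y \<noteq> 0\<^sub>v ?n \<longleftrightarrow> (\<exists>u \<in> ?V. y u \<noteq> 0)" for y
  proof -
    have "?vec y = 0\<^sub>v ?n \<longleftrightarrow> (\<forall>i < ?n. y (?l i) = 0)" by (auto simp: vec_eq_iff)
    then show ?thesis using all[of "\<lambda>u. y u = 0"] by auto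
  qed
  have eq: "adjacency_matrix G *\<^sub>v ?vec y = k \<cdot>\<^sub>v ?vec y \<longleftrightarrow>
      (\<forall>u \<in> ?V. (\<Sum>v | (u, v) \<in> parcs G. y v) = k * y u)" for y
    using all[of "\<lambda>u. (\<Sum>v | (u, v) \<in> parcs G. y v) = k * y u"]
    by (simp add: vec_eq_iff dim adjacency_matrix_mult_vec del: index_mult_mat_vec)
  have "eigenvalue (adjacency_matrix G) k \<longleftrightarrow>
      (\<exists>y. ?vec y \<noteq> 0\<^sub>v ?n \<and> adjacency_matrix G *\<^sub>v ?vec y = k \<cdot>\<^sub>v ?vec y)"
    unfolding eigenvalue_def eigenvector_def dim using vecs by (metis vec_carrier)
  then show ?thesis unfolding nz eq .
qed

text \<open>
  An eigenvector for another eigenvalue \<open>l\<close> has \<open>Q z = l \<parallel>z\<parallel>\<^sup>2\<close> with \<open>\<parallel>z\<parallel> > 0\<close>, so a lower bound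
  for the Rayleigh quotient is a lower bound for \<open>l\<close>.
\<close>

lemma (in pair_graph) least_eigenvalue_eqI:
  assumes ex: "\<exists>u \<in> pverts G. y u \<noteq> 0"
    and eig: "\<And>u. u \<in> pverts G \<Longrightarrow> (\<Sum>v | (u, v) \<in> parcs G. y v) = k * y u"
    and bound: "\<And>z. k * (\<Sum>u \<in> pverts G. (z u)\<^sup>2) \<le> adjacency_form G z"
  shows "least_eigenvalue G = k"
  unfolding least_eigenvalue_def
proof (rule Min_eqI)
  show "finite (spectrum (adjacency_matrix G))"
    by (rule card_finite_spectrum(1)[of _ "card (pverts G)"]) (simp add: adjacency_matrix_def)
  show "k \<in> spectrum (adjacency_matrix G)"
    unfolding spectrum_def using eigenvalue_adjacency_matrix_iff[of k] ex eig by auto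
  fix l assume "l \<in> spectrum (adjacency_matrix G)"
  then obtain z where z: "\<exists>u \<in> pverts G. z u \<noteq> 0"
      "\<And>u. u \<in> pverts G \<Longrightarrow> (\<Sum>v | (u, v) \<in> parcs G. z v) = l * z u"
    unfolding spectrum_def using eigenvalue_adjacency_matrix_iff[of l] by auto
  have "0 < (\<Sum>u \<in> pverts G. (z u)\<^sup>2)"
    using z(1) pair_finite_verts by (auto intro: sum_pos2)
  moreover have "k * (\<Sum>u \<in> pverts G. (z u)\<^sup>2) \<le> l * (\<Sum>u \<in> pverts G. (z u)\<^sup>2)"
    using bound[of z] adjacency_form_eigenvector[OF z(2)] by simp
  ultimately show "k \<le> l" by simp
qed

section \<open>Cuts as values of the adjacency form\<close>

definition cut_sign :: "'a set \<Rightarrow> 'a \<Rightarrow> real" where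
  "cut_sign X u = (if u \<in> X then 1 else - 1)"

lemma (in pair_graph) finite_edges: "finite (edges G)"
proof -
  have "edges G = (\<lambda>(u, v). {u, v}) ` parcs G" by (auto simp: edges_def)
  then show ?thesis using pair_finite_arcs by simp
qed

text \<open>Without loops, each edge is the set of ends of exactly two arcs.\<close>

lemma (in pair_graph) sum_arcs_eq_twice_sum_edges:
  fixes f :: "'a set \<Rightarrow> real"
  shows "(\<Sum>(u, v) \<in> parcs G. f {u, v}) = 2 * (\<Sum>e \<in> edges G. f e)"
proof -
  let ?ends = "\<lambda>(u, v). {u, v}"
  have ends: "?ends ` parcs G = edges G" by (auto simp: edges_def)
  have fib: "(\<Sum>a \<in> {a \<in> parcs G. ?ends a = e}. f (?ends a)) = 2 * f e" if "e \<in> edges G" for e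
  proof -
    from that obtain u v where uv: "e = {u, v}" "(u, v) \<in> parcs G" by (auto simp: edges_def)
    have vu: "(v, u) \<in> parcs G" using uv(2) by (rule arcs_symmetric)
    have "u \<noteq> v" using pair_no_loops[OF uv(2)] by simp
    moreover have "{a \<in> parcs G. ?ends a = e} = {(u, v), (v, u)}"
    proof (rule Set.set_eqI)
      fix a :: "'a \<times> 'a"
      obtain x y where a: "a = (x, y)" by (cases a)
      show "a \<in> {a \<in> parcs G. ?ends a = e} \<longleftrightarrow> a \<in> {(u, v), (v, u)}"
        unfolding a uv(1) using uv(2) vu
        by (simp only: mem_Collect_eq case_prod_conv doubleton_eq_iff insert_iff empty_iff
            prod.inject) blast
    qed
    moreover have "?ends (v, u) = e" unfolding uv(1) by auto
    ultimately show ?thesis by (simp add: uv(1))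
  qed
  have "(\<Sum>(u, v) \<in> parcs G. f {u, v}) = (\<Sum>a \<in> parcs G. f (?ends a))"
    by (simp add: case_prod_unfold)
  also have "\<dots> = (\<Sum>e \<in> edges G. \<Sum>a \<in> {a \<in> parcs G. ?ends a = e}. f (?ends a))"
    using sum.image_gen[OF pair_finite_arcs, of "\<lambda>a. f (?ends a)" ?ends] ends by simp
  also have "\<dots> = (\<Sum>e \<in> edges G. 2 * f e)" using fib by (intro sum.cong) auto
  finally show ?thesis by (simp add: sum_distrib_left)
qed

text \<open>
  The signs at the ends of an edge multiply to \<open>-1\<close> if the edge is cut and to \<open>1\<close> otherwise,
  which turns the maximum cut problem into minimising the adjacency form over sign vectors.
\<close>

lemma (in pair_graph) adjacency_form_cut_sign:
  "adjacency_form G (cut_sign X) = 2 * (real (card (edges G)) - 2 * real (card (cut_edges G X)))"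
proof -
  let ?f = "\<lambda>e. if card (e \<inter> X) = 1 then - 1 else 1 :: real"
  have "cut_sign X u * cut_sign X v = ?f {u, v}" if "(u, v) \<in> parcs G" for u v
  proof -
    have "u \<noteq> v" using pair_no_loops[OF that] by simp
    then show ?thesis by (simp add: cut_sign_def Int_insert_left)
  qed
  then have "adjacency_form G (cut_sign X) = (\<Sum>(u, v) \<in> parcs G. ?f {u, v})"
    unfolding adjacency_form_def by (intro sum.cong) auto
  also have "\<dots> = 2 * (\<Sum>e \<in> edges G. ?f e)" by (rule sum_arcs_eq_twice_sum_edges)
  also have "(\<Sum>e \<in> edges G. ?f e)
      = (\<Sum>e \<in> edges G. 1 - 2 * (if card (e \<inter> X) = 1 then 1 else 0))"
    by (intro sum.cong) auto
  also have "\<dots> = real (card (edges G)) - 2 * (\<Sum>e \<in> edges G. if card (e \<inter> X) = 1 then 1 else 0)"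
    by (simp only: sum_subtractf sum_distrib_left[symmetric]) simp
  also have "(\<Sum>e \<in> edges G. if card (e \<inter> X) = 1 then 1 else 0) = real (card (cut_edges G X))"
    unfolding cut_edges_def using finite_edges by (simp flip: sum.inter_filter)
  finally show ?thesis .
qed

text \<open>
  All sign vectors have squared norm \<open>n\<close>. Hence, if one of them attains the minimum \<open>k\<close> of the
  Rayleigh quotient over all real vectors, it also minimises the adjacency form among sign
  vectors, so that its cut is maximum, and its value \<open>k n = 2 (W - 2 mcut)\<close> is exactness.
\<close>

lemma (in pair_graph) A_exactI:
  assumes "pverts G \<noteq> {}" and "X \<subseteq> pverts G"
    and eig: "\<And>u. u \<in> pverts G \<Longrightarrow> (\<Sum>v | (u, v) \<in> parcs G. cut_sign X v) = k * cut_sign X u"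
    and bound: "\<And>z. k * (\<Sum>u \<in> pverts G. (z u)\<^sup>2) \<le> adjacency_form G z"
  shows "A_exact G"
proof -
  let ?cut = "\<lambda>Y. card (cut_edges G Y)"
  have norm: "(\<Sum>u \<in> pverts G. (cut_sign Y u)\<^sup>2) = real (card (pverts G))" for Y
  proof -
    have "(cut_sign Y u)\<^sup>2 = 1" for u :: 'a by (simp add: cut_sign_def)
    then show ?thesis by simp
  qed
  have X: "k * real (card (pverts G)) = 2 * (real (card (edges G)) - 2 * real (?cut X))"
    using adjacency_form_eigenvector[OF eig] by (simp add: norm adjacency_form_cut_sign)
  have "?cut Y \<le> ?cut X" for Y
    using bound[of "cut_sign Y"] X by (simp add: norm adjacency_form_cut_sign)
  then have "mcut G = ?cut X"
    unfolding mcut_def using \<open>X \<subseteq> pverts G\<close> pair_finite_verts by (intro Max_eqI) auto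
  moreover have "least_eigenvalue G = k"
  proof (rule least_eigenvalue_eqI[where y = "cut_sign X"])
    show "\<exists>u \<in> pverts G. cut_sign X u \<noteq> 0"
      using \<open>pverts G \<noteq> {}\<close> by (auto simp: cut_sign_def)
  qed (use eig bound in auto)
  moreover have "real (card (pverts G)) \<noteq> 0"
    using \<open>pverts G \<noteq> {}\<close> pair_finite_verts by simp
  ultimately show ?thesis
    using X unfolding A_exact_def by (simp add: nonzero_eq_divide_eq del: of_nat_eq_0_iff)
qed

section \<open>Joins of regular graphs\<close>

lemma regular_graph_card_nbrs:
  assumes "regular_graph r H" and "u \<in> pverts H"
  shows "card {v. (u, v) \<in> parcs H} = r"
proof -
  have "out_arcs (with_proj H) u = Pair u ` {v. (u, v) \<in> parcs H}"
    by (auto simp: out_arcs_def)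
  then have "out_degree (with_proj H) u = card {v. (u, v) \<in> parcs H}"
    by (simp add: out_degree_def card_image inj_on_def)
  then show ?thesis using assms by (simp add: regular_graph_def)
qed

text \<open>
  Subtracting the mean \<open>c\<close> from \<open>y\<close> and summing the squares \<open>((y u - c) + (y v - c))\<^sup>2\<close> over all
  arcs gives the bound. Equivalently, the form is at least \<open>-r \<parallel>z\<parallel>\<^sup>2\<close> on the part \<open>z\<close> with sum
  zero and equals \<open>r c\<^sup>2 n\<close> on the constant part. The term on the left keeps the contribution of
  the constant part, without which the bound would be too weak for joins.
\<close>

lemma adjacency_form_regular_ge:
  assumes reg: "regular_graph r H" and ne: "pverts H \<noteq> {}"
  shows "2 * real r * (\<Sum>u \<in> pverts H. y u)\<^sup>2 / card (pverts H)
    \<le> adjacency_form H y + r * (\<Sum>u \<in> pverts H. (y u)\<^sup>2)"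
proof -
  interpret pair_graph H using reg by (simp add: regular_graph_def)
  let ?V = "pverts H" and ?n = "real (card (pverts H))"
  define S T c where "S = (\<Sum>u \<in> ?V. y u)" and "T = (\<Sum>u \<in> ?V. (y u)\<^sup>2)" and "c = S / ?n"
  have n: "?n > 0" using ne pair_finite_verts by (simp add: card_gt_0_iff)
  have tails: "(\<Sum>(u, v) \<in> parcs H. f u) = r * (\<Sum>u \<in> ?V. f u)" for f :: "'a \<Rightarrow> real"
    by (simp add: sum_arcs_by_tail regular_graph_card_nbrs[OF reg] sum_distrib_left)
  have swap: "bij_betw prod.swap (parcs H) (parcs H)"
    by (rule bij_betwI[where g = prod.swap]) (auto intro: arcs_symmetric)
  have heads: "(\<Sum>(u, v) \<in> parcs H. f v) = r * (\<Sum>u \<in> ?V. f u)" for f :: "'a \<Rightarrow> real"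
    using sum.reindex_bij_betw[OF swap, of "\<lambda>(u, v). f u"] tails[of f]
    by (simp add: case_prod_unfold)
  have "0 \<le> (\<Sum>(u, v) \<in> parcs H. (y u + y v - 2 * c)\<^sup>2)"
    by (intro sum_nonneg) auto
  \<comment> \<open>By symmetry of the arcs, all terms in \<open>v\<close> alone may be counted like terms in \<open>u\<close> alone;
    so one half of the square may carry the whole constant \<open>4 c\<^sup>2\<close>.\<close>
  also have "\<dots> = (\<Sum>(u, v) \<in> parcs H. ((y u)\<^sup>2 - 4 * c * y u + 4 * c\<^sup>2))
      + (\<Sum>(u, v) \<in> parcs H. ((y v)\<^sup>2 - 4 * c * y v)) + 2 * adjacency_form H y"
    unfolding adjacency_form_def sum_distrib_left sum.distrib[symmetric]
    by (intro sum.cong) (auto simp: power2_eq_square algebra_simps)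
  also have "\<dots> = r * (T - 4 * c * S + 4 * c\<^sup>2 * ?n) + r * (T - 4 * c * S) + 2 * adjacency_form H y"
    by (subst tails, subst heads)
      (simp add: S_def T_def sum.distrib sum_subtractf sum_distrib_left[symmetric])
  also have "\<dots> = 2 * (adjacency_form H y + r * T - 2 * r * S\<^sup>2 / ?n)"
    using n by (simp add: c_def field_simps power2_eq_square)
  finally show ?thesis by (simp add: S_def T_def)
qed

lemma adjacency_form_graph_join:
  assumes "pair_graph H1" "pair_graph H2" and disj: "pverts H1 \<inter> pverts H2 = {}"
  shows "adjacency_form (graph_join H1 H2) y
    = adjacency_form H1 y + adjacency_form H2 y
      + 2 * (\<Sum>u \<in> pverts H1. y u) * (\<Sum>u \<in> pverts H2. y u)"
proof -
  interpret A: pair_graph H1 by fact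
  interpret B: pair_graph H2 by fact
  note fin = A.pair_finite_verts B.pair_finite_verts A.pair_finite_arcs B.pair_finite_arcs
  let ?f = "\<lambda>(u, v). y u * y v"
  have "parcs H1 \<subseteq> pverts H1 \<times> pverts H1" "parcs H2 \<subseteq> pverts H2 \<times> pverts H2"
    by (auto dest: A.in_arcsD1 A.in_arcsD2 B.in_arcsD1 B.in_arcsD2)
  then have d: "parcs H1 \<inter> parcs H2 = {}"
    "(parcs H1 \<union> parcs H2) \<inter> pverts H1 \<times> pverts H2 = {}"
    "(parcs H1 \<union> parcs H2 \<union> pverts H1 \<times> pverts H2) \<inter> pverts H2 \<times> pverts H1 = {}"
    using disj by blast+
  have prod: "sum ?f (A \<times> B) = (\<Sum>u \<in> A. y u) * (\<Sum>u \<in> B. y u)" for A B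
    by (simp add: sum_product sum.cartesian_product)
  have "adjacency_form (graph_join H1 H2) y = sum ?f (parcs H1) + sum ?f (parcs H2)
      + sum ?f (pverts H1 \<times> pverts H2) + sum ?f (pverts H2 \<times> pverts H1)"
    unfolding adjacency_form_def graph_join_def pair_pre_digraph.simps
    using fin d by (simp add: sum.union_disjoint)
  then show ?thesis unfolding prod by (simp add: adjacency_form_def)
qed

text \<open>
  With \<open>S1\<close>, \<open>S2\<close> the sums of \<open>y\<close> over the two sides, the bounds for the two regular graphs and
  Cauchy-Schwarz leave a quadratic form in \<open>S1\<close> and \<open>S2\<close> only. The hypothesis that ties the degrees
  to the orders makes that form the square of \<open>n2 S1 + n1 S2\<close>, up to the factor \<open>1 / (n1 n2)\<close>.
\<close>

lemma adjacency_form_join_regular_ge: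
  assumes reg1: "regular_graph r1 H1" and reg2: "regular_graph r2 H2"
    and disj: "pverts H1 \<inter> pverts H2 = {}"
    and ne: "pverts H1 \<noteq> {}" "pverts H2 \<noteq> {}"
    and n2: "real (card (pverts H2)) = d + r1" and n1: "real (card (pverts H1)) = d + r2"
    and d: "r1 \<le> d" "r2 \<le> d"
  shows "- d * (\<Sum>u \<in> pverts H1 \<union> pverts H2. (y u)\<^sup>2) \<le> adjacency_form (graph_join H1 H2) y"
proof -
  have pg: "pair_graph H1" "pair_graph H2" using reg1 reg2 by (auto simp: regular_graph_def)
  interpret A: pair_graph H1 by fact
  interpret B: pair_graph H2 by fact
  define S1 S2 T1 T2 where "S1 = (\<Sum>u \<in> pverts H1. y u)" and "S2 = (\<Sum>u \<in> pverts H2. y u)"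
    and "T1 = (\<Sum>u \<in> pverts H1. (y u)\<^sup>2)" and "T2 = (\<Sum>u \<in> pverts H2. (y u)\<^sup>2)"
  define m1 m2 where "m1 = real (card (pverts H1))" and "m2 = real (card (pverts H2))"
  have "m1 > 0" "m2 > 0"
    using ne A.pair_finite_verts B.pair_finite_verts
    by (simp_all add: m1_def m2_def card_gt_0_iff)
  then have m: "m1 > 0" "m2 > 0" "m1 = d + r2" "m2 = d + r1"
    using n1 n2 by (simp_all add: m1_def m2_def)
  define p1 p2 where "p1 = S1\<^sup>2 / m1" and "p2 = S2\<^sup>2 / m2"
  have Q1: "2 * real r1 * p1 \<le> adjacency_form H1 y + r1 * T1"
    using adjacency_form_regular_ge[OF reg1 ne(1), of y] by (simp add: S1_def T1_def m1_def p1_def)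
  have Q2: "2 * real r2 * p2 \<le> adjacency_form H2 y + r2 * T2"
    using adjacency_form_regular_ge[OF reg2 ne(2), of y] by (simp add: S2_def T2_def m2_def p2_def)
  have "S1\<^sup>2 \<le> m1 * T1" "S2\<^sup>2 \<le> m2 * T2"
    using sum_squared_le_sum_of_squares[of y "pverts H1"] sum_squared_le_sum_of_squares[of y "pverts H2"]
    by (simp_all add: S1_def S2_def T1_def T2_def m1_def m2_def mult.commute)
  then have "p1 \<le> T1" "p2 \<le> T2"
    using m by (simp_all add: p1_def p2_def field_simps)
  then have CS: "(d - r1) * p1 \<le> (d - r1) * T1" "(d - r2) * p2 \<le> (d - r2) * T2"
    using d by (simp_all add: mult_left_mono)
  have "0 \<le> (m2 * S1 + m1 * S2)\<^sup>2 / (m1 * m2)" using m(1,2) by simp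
  also have "\<dots> = m2 * p1 + m1 * p2 + 2 * S1 * S2"
    using m(1,2) by (simp add: p1_def p2_def field_simps power2_eq_square)
  also have "\<dots> = (d + r1) * p1 + (d + r2) * p2 + 2 * S1 * S2"
    using m(3,4) by simp
  also have "\<dots> \<le> adjacency_form H1 y + adjacency_form H2 y + 2 * S1 * S2 + d * (T1 + T2)"
    using Q1 Q2 CS by (simp add: algebra_simps)
  also have "\<dots> = adjacency_form (graph_join H1 H2) y + d * (T1 + T2)"
    by (simp add: adjacency_form_graph_join[OF pg disj] S1_def S2_def)
  also have "T1 + T2 = (\<Sum>u \<in> pverts H1 \<union> pverts H2. (y u)\<^sup>2)"
    unfolding T1_def T2_def
    by (rule sum.union_disjoint[OF A.pair_finite_verts B.pair_finite_verts disj, symmetric])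
  finally show ?thesis by simp
qed

theorem proposition4p5:
  fixes H1 H2 :: "'a pair_pre_digraph" and r1 r2 n1 n2 :: nat
  assumes "regular_graph r1 H1" and "card (pverts H1) = n1"
    and "regular_graph r2 H2" and "card (pverts H2) = n2"
    and "pverts H1 \<inter> pverts H2 = {}"
    and "int n1 - int r2 = int n2 - int r1"
    and "int n2 - int r1 > int (max r1 r2)"
  shows "A_exact (graph_join H1 H2)"
proof -
  have pg: "pair_graph H1" "pair_graph H2" using assms by (auto simp: regular_graph_def)
  interpret A: pair_graph H1 by fact
  interpret B: pair_graph H2 by fact
  interpret G: pair_graph "graph_join H1 H2"
    using pg assms(5) by (rule pair_graph_graph_join)
  note disj = assms(5)
  define d where "d = real n2 - real r1"
  have n: "real n2 = d + r1" "real n1 = d + r2" and d: "r1 \<le> d" "r2 \<le> d"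
    using assms(6,7) by (auto simp: d_def)
  have "n1 > 0" "n2 > 0" using assms(6,7) by auto
  then have ne: "pverts H1 \<noteq> {}" "pverts H2 \<noteq> {}" using assms(2,4) by auto
  let ?x = "cut_sign (pverts H1)"
  show ?thesis
  proof (rule G.A_exactI[where X = "pverts H1" and k = "- d"])
    show "pverts (graph_join H1 H2) \<noteq> {}" "pverts H1 \<subseteq> pverts (graph_join H1 H2)"
      using ne by (auto simp: graph_join_def)
    show "- d * (\<Sum>u \<in> pverts (graph_join H1 H2). (z u)\<^sup>2) \<le> adjacency_form (graph_join H1 H2) z" for z
      using adjacency_form_join_regular_ge[OF assms(1,3) disj ne _ _ d, of z] n assms(2,4)
      by (simp add: graph_join_def)
    have x: "(\<Sum>v \<in> N. ?x v) = card N" if "N \<subseteq> pverts H1" for N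
    proof -
      have "(\<Sum>v \<in> N. ?x v) = (\<Sum>v \<in> N. 1)"
        using that by (intro sum.cong) (auto simp: cut_sign_def)
      then show ?thesis by simp
    qed
    have x': "(\<Sum>v \<in> N. ?x v) = - card N" if "N \<subseteq> pverts H2" for N
    proof -
      have "(\<Sum>v \<in> N. ?x v) = (\<Sum>v \<in> N. - 1)"
        using that disj by (intro sum.cong) (auto simp: cut_sign_def)
      then show ?thesis by simp
    qed
    fix u assume "u \<in> pverts (graph_join H1 H2)"
    then consider (1) "u \<in> pverts H1" "u \<notin> pverts H2" | (2) "u \<in> pverts H2" "u \<notin> pverts H1"
      using disj by (auto simp: graph_join_def)
    then show "(\<Sum>v | (u, v) \<in> parcs (graph_join H1 H2). ?x v) = - d * ?x u"
    proof cases
      case 1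
      let ?N = "{v. (u, v) \<in> parcs H1}"
      have N: "?N \<subseteq> pverts H1" by (auto dest: A.in_arcsD2)
      have "{v. (u, v) \<in> parcs (graph_join H1 H2)} = ?N \<union> pverts H2"
        using 1 by (auto simp: graph_join_def dest: B.in_arcsD1)
      moreover have "sum ?x (?N \<union> pverts H2) = sum ?x ?N + sum ?x (pverts H2)"
        using N disj by (intro sum.union_disjoint A.finite_nbrs B.pair_finite_verts) auto
      moreover have "?x u = 1" using 1 by (simp add: cut_sign_def)
      ultimately show ?thesis
        using 1 n assms(4) regular_graph_card_nbrs[OF assms(1)]
        by (simp add: x[OF N] x')
    next
      case 2
      let ?N = "{v. (u, v) \<in> parcs H2}"
      have N: "?N \<subseteq> pverts H2" by (auto dest: B.in_arcsD2)
      have "{v. (u, v) \<in> parcs (graph_join H1 H2)} = pverts H1 \<union> ?N"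
        using 2 by (auto simp: graph_join_def dest: A.in_arcsD1)
      moreover have "sum ?x (pverts H1 \<union> ?N) = sum ?x (pverts H1) + sum ?x ?N"
        using N disj by (intro sum.union_disjoint B.finite_nbrs A.pair_finite_verts) auto
      moreover have "?x u = - 1" using 2 by (simp add: cut_sign_def)
      ultimately show ?thesis
        using 2 n assms(2) regular_graph_card_nbrs[OF assms(3)]
        by (simp add: x'[OF N] x)
    qed
  qed
qed

end
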